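(* Let $n\ge1$ and let $\mathcal{L}$ be the sub-Laplacian on $\mathbb{CP}^{2n+1}$ obtained by lifting the Laplace–Beltrami operator of $\mathbb{HP}^n$ through the fibration $\mathbb{CP}^1\to\mathbb{CP}^{2n+1}\to\mathbb{HP}^n$. The radial (cylindric) part of $\mathcal{L}$, i.e. its action on functions depending only on $(r,\phi)$, is $$\tilde{\mathcal{L}}=\frac{\partial^2}{\partial r^2}+\big((4n-1)\cot r-3\tan r\big)\frac{\partial}{\partial r}+\tan^2 r\left(\frac{\partial^2}{\partial\phi^2}+2\cot 2\phi\,\frac{\partial}{\partial\phi}\right).$$
   Context: $\mathbb{S}^{4n+3}=\{q\in\mathbb{H}^{n+1}:\|q\|=1\}$ ($\mathbb{H}$ the quaternions) with its round metric and Laplace–Beltrami operator $\Delta$. The unit quaternions $\mathbf{SU}(2)$ act isometrically by $g\cdot(q_1,\dots,q_{n+1})=(gq_1,\dots,gq_{n+1})$ with quotient $\mathbb{HP}^n$; the subgroup $\mathbb{S}^1=\{e^{I\theta}\}$ has quotient $\mathbb{CP}^{2n+1}$, and this induces the fibration $\mathbf{SU}(2)/\mathbb{S}^1=\mathbb{CP}^1\to\mathbb{CP}^{2n+1}\to\mathbb{HP}^n$ (all quotient metrics being such that the projections are Riemannian submersions). The sub-Laplacian $\mathcal{L}$ is the lift of the Laplace–Beltrami operator of $\mathbb{HP}^n$ to $\mathbb{CP}^{2n+1}$; equivalently, it is the projection to $\mathbb{CP}^{2n+1}$ of the sub-Laplacian $L=\Delta-T_1^2-T_2^2-T_3^2$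 of $\mathbb{S}^{4n+3}$, where $T_1,T_2,T_3$ are the unit-length generators $f\mapsto\frac{d}{d\theta}|_{\theta=0}f(e^{S\theta}q)$, $S=I,J,K$. Coordinates on $\mathbb{CP}^{2n+1}$: $r\in[0,\pi/2)$ is the Riemannian distance on $\mathbb{HP}^n$ from the image of the north pole $(0,\dots,0,1)$, $|q_{n+1}|=\cos r$; and $\phi\in[0,\pi/2]$ is the Riemannian distance on $\mathbb{CP}^1=\mathbf{SU}(2)/\mathbb{S}^1$ (a sphere of radius $1/2$) from the class of the identity to the class of $q_{n+1}/|q_{n+1}|$, so that if $q_{n+1}/|q_{n+1}|=a+bJ$ with $a,b\in\mathrm{span}_{\mathbb{R}}(1,I)$ then $|a|=\cos\phi$. The formula is understood at interior points $0<r<\pi/2$, $0<\phi<\pi/2$. *)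

theory Defs
  imports "HOL-Analysis.Analysis"
begin

section \<open>Quaternions and the actions on the sphere\<close>

text \<open>The pair \<open>(a, b)\<close> stands for the quaternion \<open>a + b J\<close>, where \<open>a\<close> and \<open>b\<close> lie in the span of
  \<open>1\<close> and \<open>I\<close>, identified with the complex numbers. The product below follows from
  \<open>J c = cnj c J\<close>. Norm and real inner product are those of the product type.\<close>

type_synonym quat = "complex \<times> complex"

definition qone :: quat where "qone = (1, 0)"
definition qI :: quat where "qI = (\<i>, 0)"
definition qJ :: quat where "qJ = (0, 1)"
definition qK :: quat where "qK = (0, \<i>)"

definition qmult :: "quat \<Rightarrow> quat \<Rightarrow> quat" where
  "qmult p q = (fst p * fst q - snd p * cnj (snd q), fst p * snd q + snd p * cnj (fst q))"

lemma quaternion_relations: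
  "qmult qI qI = - qone" "qmult qJ qJ = - qone" "qmult qK qK = - qone"
  "qmult qI qJ = qK" "qmult qJ qK = qI" "qmult qK qI = qJ"
  by (simp_all add: qmult_def qone_def qI_def qJ_def qK_def)

text \<open>\<open>exp (\<theta> S)\<close> for an imaginary unit \<open>S\<close>.\<close>

definition qexp :: "quat \<Rightarrow> real \<Rightarrow> quat" where
  "qexp S \<theta> = cos \<theta> *\<^sub>R qone + sin \<theta> *\<^sub>R S"

text \<open>The space of \<open>(n+1)\<close>-tuples of quaternions with \<open>n = CARD('n)\<close>; the second component is the
  last coordinate. The type is a Euclidean space, and the sphere of dimension \<open>4n+3\<close> is
  \<open>sphere 0 1\<close> in it.\<close>

type_synonym 'n hspace = "(quat ^ 'n) \<times> quat"

definition qact :: "quat \<Rightarrow> 'n::finite hspace \<Rightarrow> 'n hspace" where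
  "qact g p = ((\<chi> k. qmult g (fst p $ k)), qmult g (snd p))"

definition north_pole :: "'n::finite hspace" where
  "north_pole = (0, qone)"

definition cp_class :: "'n::finite hspace \<Rightarrow> 'n hspace set" where
  "cp_class p = range (\<lambda>\<theta>. qact (qexp qI \<theta>) p)"

definition hp_class :: "'n::finite hspace \<Rightarrow> 'n hspace set" where
  "hp_class p = (\<lambda>g. qact g p) ` sphere 0 1"

definition cp_space :: "'n::finite hspace set set" where
  "cp_space = cp_class ` sphere 0 1"

definition cp_to_hp :: "'n::finite hspace set \<Rightarrow> 'n hspace set" where
  "cp_to_hp x = (\<Union>p\<in>x. hp_class p)"


section \<open>The cylindric coordinates\<close>

text \<open>The Riemannian distance between points \<open>p\<close>, \<open>q\<close> of a round unit sphere is \<open>arccos (p \<bullet> q)\<close>.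
  The quotient metric making the projection onto the orbit space of an isometric action of a
  compact group a Riemannian submersion has as its distance the distance between orbits.\<close>

definition orbit_dist :: "'a::euclidean_space set \<Rightarrow> 'a set \<Rightarrow> real" where
  "orbit_dist X Y = Inf {arccos (p \<bullet> q) | p q. p \<in> X \<and> q \<in> Y}"

definition cp_r :: "'n::finite hspace set \<Rightarrow> real" where
  "cp_r x = orbit_dist (hp_class north_pole) (cp_to_hp x)"

text \<open>The second argument of \<open>orbit_dist\<close> below is the circle orbit in \<open>SU(2)\<close> of the normalized last
  coordinate of any representative of \<open>x\<close>. It is meaningful only if that coordinate is not zero,
  that is, if \<open>cp_r x < pi / 2\<close>.\<close>

definition cp_phi :: "'n::finite hspace set \<Rightarrow> real" where
  "cp_phi x = orbit_dist (range (qexp qI)) ((\<lambda>p. snd p /\<^sub>R norm (snd p)) ` x)"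


section \<open>The Laplace--Beltrami operator of the round sphere\<close>

definition sphere_grad :: "('a::euclidean_space \<Rightarrow> real) \<Rightarrow> 'a \<Rightarrow> 'a" where
  "sphere_grad f p =
     (THE w. w \<bullet> p = 0 \<and> (f has_derivative (\<lambda>v. w \<bullet> v)) (at p within sphere 0 1))"

definition tangent_proj :: "'a::euclidean_space \<Rightarrow> 'a \<Rightarrow> 'a" where
  "tangent_proj p v = v - (v \<bullet> p) *\<^sub>R p"

text \<open>The divergence is the trace, on the tangent space at \<open>p\<close>, of the covariant derivative
  \<open>v \<mapsto> tangent_proj p (DX v)\<close>. Writing \<open>P = tangent_proj p\<close>, this is the trace of
  \<open>P \<circ> DX \<circ> P\<close> on the ambient space. The derivative of \<open>X\<close> within the sphere is determined only
  on tangent vectors, and it is only applied to those.\<close>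

definition sphere_div :: "('a::euclidean_space \<Rightarrow> 'a) \<Rightarrow> 'a \<Rightarrow> real" where
  "sphere_div X p =
     (\<Sum>b\<in>Basis. frechet_derivative X (at p within sphere 0 1) (tangent_proj p b) \<bullet> tangent_proj p b)"

definition sphere_laplacian :: "('a::euclidean_space \<Rightarrow> real) \<Rightarrow> 'a \<Rightarrow> real" where
  "sphere_laplacian f = sphere_div (sphere_grad f)"


section \<open>The sub-Laplacians\<close>

definition T_op :: "quat \<Rightarrow> ('n::finite hspace \<Rightarrow> real) \<Rightarrow> 'n hspace \<Rightarrow> real" where
  "T_op S f q = deriv (\<lambda>\<theta>. f (qact (qexp S \<theta>) q)) 0"

definition sphere_sublaplacian :: "('n::finite hspace \<Rightarrow> real) \<Rightarrow> 'n hspace \<Rightarrow> real" where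
  "sphere_sublaplacian f q = sphere_laplacian f q
     - T_op qI (T_op qI f) q - T_op qJ (T_op qJ f) q - T_op qK (T_op qK f) q"

text \<open>The projected operator is characterized by
  \<open>cp_sublaplacian f (cp_class p) = sphere_sublaplacian (f \<circ> cp_class) p\<close> for \<open>p\<close> in the sphere:
  its value at \<open>x\<close> is the common value of the right-hand side over all representatives of \<open>x\<close>.\<close>

definition cp_sublaplacian ::
    "('n::finite hspace set \<Rightarrow> real) \<Rightarrow> 'n hspace set \<Rightarrow> real" where
  "cp_sublaplacian f x = (THE c. \<forall>p\<in>x. sphere_sublaplacian (f \<circ> cp_class) p = c)"


section \<open>Twice continuously differentiable functions\<close>

definition C2_on :: "('a::real_normed_vector \<Rightarrow> 'b::real_normed_vector) \<Rightarrow> 'a set \<Rightarrow> bool" where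
  "C2_on f U \<longleftrightarrow> (\<exists>D D2.
     (\<forall>z\<in>U. (f has_derivative blinfun_apply (D z)) (at z) \<and>
             (D has_derivative blinfun_apply (D2 z)) (at z)) \<and>
     continuous_on U D2)"

end

(* In a neighbourhood of the given point a radial function on the sphere depends on the last coordinate q
   alone, so it extends to the ambient space as h = g o snd. With H the second derivative of g, the sphere
   Laplacian at a unit vector p is tr H - H(q,q) - (4n+3) Dg(q), and along q, Iq, Jq, Kq, which are
   orthogonal of length |q|, T_S^2 = H(Sq,Sq) - Dg(q). Hence the sub-Laplacian is
   (1 - |q|^2) tr H - 4n Dg(q). The trace is evaluated in an orthonormal frame at q whose four directions
   are tangent to curves along which only r varies, only phi varies, or g is constant; since
   (g o c)'' = H(c',c') + Dg(c''), explicit derivatives of r and phi are never needed. *)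
theory Submission
  imports Defs
begin

section \<open>Laplacian of a restriction to the sphere\<close>

text \<open>The first-order coefficients are accelerations of curves. Each of the three curves that
  keep |q| fixed (the one moving phi and the two rotating the phase of a component of q) bends
  towards the origin, and each contributes one -tan r. The r-curve runs along a ray with speed sin r
  and acceleration -q; this lowers the 4n cot r coming from -4n Dg(q) to (4n-1) cot r. The two phase
  rotations also bend in the phi-direction, with coefficients -tan phi and cot phi, whose sum is 2
  cot 2phi. Two obstacles shape the statements. The function is described by F only at interior
  points, so every identity that gets differentiated must be shown to hold in a neighbourhood. And
  gradient and divergence are defined by derivatives within the sphere, which are determined on
  tangent vectors only.\<close>

lemma eventually_nhds_isCont:
  fixes c :: "'a::t2_space \<Rightarrow> 'b::topological_space"
  assumes "isCont c t" "open U" "c t \<in> U"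
  shows "\<forall>\<^sub>F s in nhds t. c s \<in> U"
  using assms topological_tendstoD[of c "c t" "nhds t" U]
  by (simp add: isCont_def tendsto_at_iff_tendsto_nhds)

text \<open>The chain rule applied twice. A curve with known velocity and acceleration converts
  one-variable derivatives, of F in one coordinate or of a function along a group orbit, into values
  of \<open>D2\<close> and \<open>D\<close>.\<close>

lemma deriv_along_curve:
  fixes g :: "'a::real_normed_vector \<Rightarrow> real" and c c1 :: "real \<Rightarrow> 'a"
  assumes U: "open U" "c t0 \<in> U"
    and D: "\<And>z. z \<in> U \<Longrightarrow> (g has_derivative blinfun_apply (D z)) (at z)"
    and D2: "(D has_derivative D2) (at (c t0))"
    and c1: "\<And>t. (c has_vector_derivative c1 t) (at t)"
    and c2: "(c1 has_vector_derivative c2) (at t0)"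
    and psi: "\<forall>\<^sub>F t in nhds t0. \<psi> t = g (c t)"
  shows "deriv \<psi> t0 = D (c t0) (c1 t0)"
    and "deriv (deriv \<psi>) t0 = D2 (c1 t0) (c1 t0) + D (c t0) c2"
proof -
  have "isCont c t0"
    using c1 has_vector_derivative_continuous by blast
  then have "\<forall>\<^sub>F t in nhds t0. c t \<in> U"
    using U by (rule eventually_nhds_isCont)
  \<comment> \<open>Agreement near \<open>t0\<close> is also agreement near every \<open>t\<close>
    close to \<open>t0\<close>. This gives the first derivative at all these \<open>t\<close>, as
    needed to differentiate it again.\<close>
  then have "\<forall>\<^sub>F t in nhds t0. c t \<in> U \<and> (\<forall>\<^sub>F s in nhds t. \<psi> s = g (c s))"
    using psi by (simp add: eventually_eventually eventually_conj)
  then have ev: "\<forall>\<^sub>F t in nhds t0. deriv \<psi> t = D (c t) (c1 t)"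
  proof eventually_elim
    case (elim t)
    have "((g \<circ> c) has_vector_derivative D (c t) (c1 t)) (at t)"
      using vector_derivative_diff_chain_within[OF c1, of g "blinfun_apply (D (c t))" t] D[of "c t"] elim
      by (auto intro: has_derivative_at_withinI)
    then have "((\<lambda>s. g (c s)) has_real_derivative D (c t) (c1 t)) (at t)"
      by (simp add: o_def has_real_derivative_iff_has_vector_derivative)
    then have "(\<psi> has_real_derivative D (c t) (c1 t)) (at t)"
      using DERIV_cong_ev[OF refl conjunct2[OF elim] refl] by blast
    then show ?case by (rule DERIV_imp_deriv)
  qed
  show "deriv \<psi> t0 = D (c t0) (c1 t0)"
    using ev eventually_nhds_x_imp_x by blast
  have "((D \<circ> c) has_vector_derivative D2 (c1 t0)) (at t0)"
    using vector_derivative_diff_chain_within[OF c1, of D D2 t0] D2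
    by (auto intro: has_derivative_at_withinI)
  from bounded_bilinear.has_vector_derivative[OF bounded_bilinear_blinfun_apply this c2]
  have "((\<lambda>t. D (c t) (c1 t)) has_vector_derivative D2 (c1 t0) (c1 t0) + D (c t0) c2) (at t0)"
    by (simp add: add.commute)
  then have "((\<lambda>t. D (c t) (c1 t)) has_real_derivative D2 (c1 t0) (c1 t0) + D (c t0) c2) (at t0)"
    by (simp add: has_real_derivative_iff_has_vector_derivative)
  then have "(deriv \<psi> has_real_derivative D2 (c1 t0) (c1 t0) + D (c t0) c2) (at t0)"
    using DERIV_cong_ev[OF refl ev refl] by blast
  then show "deriv (deriv \<psi>) t0 = D2 (c1 t0) (c1 t0) + D (c t0) c2"
    by (rule DERIV_imp_deriv)
qed

text \<open>A tangent direction is the velocity of a great circle through \<open>p\<close>. That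
  circle stays in the sphere, so either candidate, applied to the direction, is the ordinary
  derivative of \<open>X\<close> along the circle.\<close>

lemma has_derivative_within_sphere_unique:
  fixes X :: "'a::euclidean_space \<Rightarrow> 'b::real_normed_vector"
  assumes L: "(X has_derivative L) (at p within sphere 0 1)"
    and L': "(X has_derivative L') (at p within sphere 0 1)"
    and p: "norm p = 1" and v: "v \<bullet> p = 0"
  shows "L v = L' v"
proof (cases "v = 0")
  case True
  then show ?thesis
    using L L' by (metis has_derivative_bounded_linear linear_0 bounded_linear.linear)
next
  case False
  define w where "w = v /\<^sub>R norm v"
  have w: "norm w = 1" "w \<bullet> p = 0" and vw: "v = norm v *\<^sub>R w"
    using False v by (simp_all add: w_def)
  define c where "c t = cos t *\<^sub>R p + sin t *\<^sub>R w" for t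
  have "norm (c t) = 1" for t
  proof -
    have "(norm (c t))\<^sup>2 = (cos t)\<^sup>2 * (p \<bullet> p) + (sin t)\<^sup>2 * (w \<bullet> w)"
      using w(2) unfolding power2_norm_eq_inner c_def
      by (simp add: inner_left_distrib inner_right_distrib inner_commute power2_eq_square)
    then have "(norm (c t))\<^sup>2 = 1"
      using p w(1) by (simp add: norm_eq_1)
    then show ?thesis
      using norm_ge_zero[of "c t"] by (smt (verit) power2_eq_1_iff)
  qed
  then have im: "c ` UNIV \<subseteq> sphere 0 1" by auto
  have c0: "c 0 = p" by (simp add: c_def)
  have dc: "(c has_vector_derivative w) (at 0)"
    unfolding c_def by (auto intro!: derivative_eq_intros)
  have *: "((X \<circ> c) has_vector_derivative M w) (at 0)"
    if "(X has_derivative M) (at p within sphere 0 1)" for M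
    using vector_derivative_diff_chain_within[OF dc, of X M] has_derivative_subset[OF that im] c0
    by simp
  have "L w = L' w"
    using vector_derivative_unique_at[OF *[OF L] *[OF L']] .
  then show ?thesis
    using L L' vw by (metis has_derivative_bounded_linear linear_cmul bounded_linear.linear)
qed

lemma tangent_proj_orthogonal:
  "norm p = 1 \<Longrightarrow> tangent_proj p v \<bullet> p = 0"
  by (simp add: tangent_proj_def inner_diff_left inner_diff_right norm_eq_1)

lemma sphere_grad_eqI:
  assumes w: "w \<bullet> p = 0" "(f has_derivative (\<lambda>v. w \<bullet> v)) (at p within sphere 0 1)"
    and p: "norm p = 1"
  shows "sphere_grad f p = w"
  unfolding sphere_grad_def
proof (rule the_equality)
  fix w' assume w': "w' \<bullet> p = 0 \<and> (f has_derivative (\<lambda>v. w' \<bullet> v)) (at p within sphere 0 1)"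
  \<comment> \<open>Both candidates are tangent, hence so is their difference, and it may serve as
    the test vector.\<close>
  have "w' \<bullet> (w' - w) = w \<bullet> (w' - w)"
    by (rule has_derivative_within_sphere_unique[OF conjunct2[OF w'] w(2) p])
      (use w(1) w' in \<open>simp add: inner_diff_left\<close>)
  then have "(w' - w) \<bullet> (w' - w) = 0"
    by (simp add: inner_diff_left)
  then show "w' = w" by simp
qed (use w in simp)

text \<open>The spherical gradient is the tangential part G z - (G z \<bullet> z) z of the ambient
  gradient. Differentiating the subtracted normal part gives, in tangent directions and up to normal
  vectors, -(G p \<bullet> p) times the identity, whose trace on the tangent space is DIM - 1 times
  -D p p. Restricting the trace of \<open>D2\<close> to the tangent space removes
  \<open>D2 p p\<close>.\<close>

lemma sphere_laplacian_extension:
  fixes h :: "'a::euclidean_space \<Rightarrow> real"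
  assumes V: "open V" "p \<in> V" and p: "norm p = 1"
    and D: "\<And>z. z \<in> V \<Longrightarrow> (h has_derivative blinfun_apply (D z)) (at z)"
    and D2: "(D has_derivative D2) (at p)"
    and u: "\<And>z. z \<in> V \<Longrightarrow> norm z = 1 \<Longrightarrow> u z = h z"
  shows "sphere_laplacian u p =
    (\<Sum>b\<in>Basis. D2 b b) - D2 p p - (real DIM('a) - 1) * D p p"
proof -
  define G where "G z = (\<Sum>b\<in>Basis. D z b *\<^sub>R b)" for z
  define G' where "G' v = (\<Sum>b\<in>Basis. D2 v b *\<^sub>R b)" for v
  have G: "G z \<bullet> v = D z v" for z v
  proof -
    have "D z v = D z (\<Sum>b\<in>Basis. (v \<bullet> b) *\<^sub>R b)"
      by (simp add: euclidean_representation)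
    also have "\<dots> = G z \<bullet> v"
      by (simp add: G_def blinfun.sum_right blinfun.scaleR_right inner_sum_left inner_commute[of v] mult.commute)
    finally show ?thesis ..
  qed
  have G': "G' w \<bullet> v = D2 w v" for w v
  proof -
    have "D2 w v = D2 w (\<Sum>b\<in>Basis. (v \<bullet> b) *\<^sub>R b)"
      by (simp add: euclidean_representation)
    also have "\<dots> = G' w \<bullet> v"
      by (simp add: G'_def blinfun.sum_right blinfun.scaleR_right inner_sum_left inner_commute[of v] mult.commute)
    finally show ?thesis ..
  qed
  have dG: "(G has_derivative G') (at p)"
    unfolding G_def G'_def
    by (intro derivative_intros bounded_linear.has_derivative[OF _ D2]
        bounded_bilinear.bounded_linear_left[OF bounded_bilinear_blinfun_apply])
  have grad: "sphere_grad u z = tangent_proj z (G z)" if z: "z \<in> V" "norm z = 1" for z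
  proof (rule sphere_grad_eqI)
    \<comment> \<open>The subtracted term vanishes on the sphere and cancels the normal component of the gradient.\<close>
    have "((\<lambda>y. h y - (G z \<bullet> z) / 2 * (y \<bullet> y - 1)) has_derivative
        (\<lambda>v. tangent_proj z (G z) \<bullet> v)) (at z within sphere 0 1)"
      by (rule derivative_eq_intros has_derivative_at_withinI[OF D[OF z(1)]] refl)+
        (auto simp: G[symmetric] tangent_proj_def inner_diff_left inner_diff_right inner_commute fun_eq_iff)
    moreover have "\<forall>\<^sub>F y in at z within sphere 0 1. h y - (G z \<bullet> z) / 2 * (y \<bullet> y - 1) = u y"
      using eventually_at_in_open'[OF V(1) z(1)]
      unfolding eventually_at_filter
      by (rule eventually_mono) (auto simp: u norm_eq_1)
    ultimately show "(u has_derivative (\<lambda>v. tangent_proj z (G z) \<bullet> v)) (at z within sphere 0 1)"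
      using z u by (elim has_derivative_transform_eventually) (auto simp: norm_eq_1)
  qed (use z in \<open>auto simp: tangent_proj_orthogonal\<close>)
  \<comment> \<open>The product rule for G z - (G z \<bullet> z) z; the multiple of \<open>p\<close>
    disappears when paired with a tangent vector.\<close>
  define X' where "X' v = G' v - ((G p \<bullet> p) *\<^sub>R v + (G p \<bullet> v + G' v \<bullet> p) *\<^sub>R p)" for v
  have "((\<lambda>z. tangent_proj z (G z)) has_derivative X') (at p within sphere 0 1)"
    unfolding tangent_proj_def X'_def
    by (rule has_derivative_at_withinI) (auto intro!: derivative_eq_intros dG)
  moreover have "\<forall>\<^sub>F y in at p within sphere 0 1. tangent_proj y (G y) = sphere_grad u y"
    using eventually_at_in_open'[OF V(1,2)]
    unfolding eventually_at_filter
    by (rule eventually_mono) (auto simp: grad)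
  ultimately have X': "(sphere_grad u has_derivative X') (at p within sphere 0 1)"
    using V p grad by (elim has_derivative_transform_eventually) auto
  then have fd: "(sphere_grad u has_derivative frechet_derivative (sphere_grad u) (at p within sphere 0 1))
      (at p within sphere 0 1)"
    using frechet_derivative_works differentiable_def by blast
  have lin: "linear D2"
    using D2 has_derivative_linear by blast
  note D2_simps = linear_diff[OF lin] linear_cmul[OF lin] blinfun.diff_left blinfun.diff_right
    blinfun.scaleR_left blinfun.scaleR_right
  \<comment> \<open>\<open>frechet_derivative\<close> is a choice among possibly many derivatives
    within the sphere. It agrees with \<open>X'\<close> here because it is applied to a tangent
    vector.\<close>
  have summand: "frechet_derivative (sphere_grad u) (at p within sphere 0 1) (tangent_proj p b) \<bullet> tangent_proj p b
      = D2 b b - (b \<bullet> p) * D2 b p - (b \<bullet> p) * D2 p b + (b \<bullet> p)\<^sup>2 * D2 p p - D p p * (1 - (b \<bullet> p)\<^sup>2)"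
    if b: "b \<in> Basis" for b
  proof -
    have t: "tangent_proj p b \<bullet> p = 0" using p by (rule tangent_proj_orthogonal)
    have "frechet_derivative (sphere_grad u) (at p within sphere 0 1) (tangent_proj p b) = X' (tangent_proj p b)"
      using has_derivative_within_sphere_unique[OF fd X' p t] .
    moreover have "X' (tangent_proj p b) \<bullet> tangent_proj p b =
        D2 (tangent_proj p b) (tangent_proj p b) - D p p * (tangent_proj p b \<bullet> tangent_proj p b)"
      using t by (simp add: X'_def inner_diff_left inner_add_left G G' inner_commute[of p "tangent_proj p b"])
    moreover have "tangent_proj p b \<bullet> tangent_proj p b = 1 - (b \<bullet> p)\<^sup>2"
      using b p by (simp add: tangent_proj_def inner_diff_left inner_diff_right norm_eq_1 inner_commute power2_eq_square)
    moreover have "D2 (tangent_proj p b) (tangent_proj p b) =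
        D2 b b - (b \<bullet> p) * D2 b p - (b \<bullet> p) * D2 p b + (b \<bullet> p)\<^sup>2 * D2 p p"
      by (simp add: tangent_proj_def D2_simps algebra_simps power2_eq_square)
    ultimately show ?thesis by simp
  qed
  have s1: "(\<Sum>b\<in>Basis. (b \<bullet> p) * D2 b p) = D2 p p"
  proof -
    have "D2 p p = D2 (\<Sum>b\<in>Basis. (p \<bullet> b) *\<^sub>R b) p"
      by (simp add: euclidean_representation)
    then show ?thesis
      by (simp add: linear_sum[OF lin] linear_cmul[OF lin] blinfun.sum_left blinfun.scaleR_left inner_commute)
  qed
  have s2: "(\<Sum>b\<in>Basis. (b \<bullet> p) * D2 p b) = D2 p p"
  proof -
    have "D2 p p = D2 p (\<Sum>b\<in>Basis. (p \<bullet> b) *\<^sub>R b)"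
      by (simp add: euclidean_representation)
    then show ?thesis
      by (simp add: blinfun.sum_right blinfun.scaleR_right inner_commute)
  qed
  have s3: "(\<Sum>b\<in>Basis. (b \<bullet> p)\<^sup>2) = 1"
    using p by (metis (no_types, lifting) euclidean_inner inner_commute norm_eq_1 power2_eq_square sum.cong)
  show ?thesis
    \<comment> \<open>The mixed terms sum to -2 \<open>D2 p p\<close> and the quadratic one to +
      \<open>D2 p p\<close>; the sum of 1 - (b \<bullet> p)^2 over the basis is DIM - 1.\<close>
    unfolding sphere_laplacian_def sphere_div_def
    by (simp add: summand sum.distrib sum_subtractf s1 s2 s3 flip: sum_distrib_left sum_distrib_right)
qed

section \<open>Twice differentiable functions\<close>

text \<open>The second derivative enters only as differentiability of \<open>D\<close>, so the
  closure rules below need no formula for it.\<close>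

definition twice_differentiable_on ::
    "('a::real_normed_vector \<Rightarrow> 'b::real_normed_vector) \<Rightarrow> 'a set \<Rightarrow> bool" where
  "twice_differentiable_on f U \<longleftrightarrow>
     (\<exists>D. \<forall>z\<in>U. (f has_derivative blinfun_apply (D z)) (at z) \<and> D differentiable at z)"

lemma twice_differentiable_onI:
  assumes "\<And>z. z \<in> U \<Longrightarrow> (f has_derivative blinfun_apply (D z)) (at z)"
    and "\<And>z. z \<in> U \<Longrightarrow> D differentiable at z"
  shows "twice_differentiable_on f U"
  using assms unfolding twice_differentiable_on_def by blast

lemma C2_on_imp_twice_differentiable_on: "C2_on f U \<Longrightarrow> twice_differentiable_on f U"
  unfolding C2_on_def twice_differentiable_on_def differentiable_def by blast

lemma twice_differentiable_on_bounded_linear: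
  assumes "bounded_linear f"
  shows "twice_differentiable_on f U"
  by (rule twice_differentiable_onI[where D = "\<lambda>_. Blinfun f"])
    (simp_all add: bounded_linear_Blinfun_apply assms bounded_linear_imp_has_derivative)

lemma twice_differentiable_on_compose:
  assumes f: "twice_differentiable_on f U" and g: "twice_differentiable_on g V"
    and UV: "\<And>z. z \<in> U \<Longrightarrow> f z \<in> V"
  shows "twice_differentiable_on (\<lambda>z. g (f z)) U"
proof -
  obtain Df where Df: "\<And>z. z \<in> U \<Longrightarrow> (f has_derivative blinfun_apply (Df z)) (at z)"
    "\<And>z. z \<in> U \<Longrightarrow> Df differentiable at z"
    using f unfolding twice_differentiable_on_def by blast
  obtain Dg where Dg: "\<And>z. z \<in> V \<Longrightarrow> (g has_derivative blinfun_apply (Dg z)) (at z)"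
    "\<And>z. z \<in> V \<Longrightarrow> Dg differentiable at z"
    using g unfolding twice_differentiable_on_def by blast
  show ?thesis
  proof (rule twice_differentiable_onI[where D = "\<lambda>z. Dg (f z) o\<^sub>L Df z"])
    fix z assume z: "z \<in> U"
    show "((\<lambda>z. g (f z)) has_derivative blinfun_apply (Dg (f z) o\<^sub>L Df z)) (at z)"
      by (rule has_derivative_eq_rhs[OF has_derivative_compose[OF Df(1)[OF z] Dg(1)[OF UV[OF z]]]])
        (simp add: fun_eq_iff)
    have "(Dg \<circ> f) differentiable at z"
      using z Df(1) Dg(2) UV by (intro differentiable_chain_at) (auto simp: differentiable_def)
    then obtain A where A: "((\<lambda>z. Dg (f z)) has_derivative A) (at z)"
      by (auto simp: differentiable_def o_def)
    obtain B where B: "(Df has_derivative B) (at z)"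
      using Df(2)[OF z] by (auto simp: differentiable_def)
    show "(\<lambda>z. Dg (f z) o\<^sub>L Df z) differentiable at z"
      using bounded_bilinear.FDERIV[OF bounded_bilinear_blinfun_compose A B]
      unfolding differentiable_def by blast
  qed
qed

lemma twice_differentiable_on_add:
  assumes f: "twice_differentiable_on f U" and g: "twice_differentiable_on g U"
  shows "twice_differentiable_on (\<lambda>z. f z + g z) U"
proof -
  obtain Df where Df: "\<And>z. z \<in> U \<Longrightarrow> (f has_derivative blinfun_apply (Df z)) (at z)"
    "\<And>z. z \<in> U \<Longrightarrow> Df differentiable at z"
    using f unfolding twice_differentiable_on_def by blast
  obtain Dg where Dg: "\<And>z. z \<in> U \<Longrightarrow> (g has_derivative blinfun_apply (Dg z)) (at z)"
    "\<And>z. z \<in> U \<Longrightarrow> Dg differentiable at z"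
    using g unfolding twice_differentiable_on_def by blast
  show ?thesis
    by (rule twice_differentiable_onI[where D = "\<lambda>z. Df z + Dg z"])
      (auto simp: plus_blinfun.rep_eq intro!: has_derivative_add Df Dg differentiable_add)
qed

lemma twice_differentiable_on_Pair:
  assumes f: "twice_differentiable_on f U" and g: "twice_differentiable_on g U"
  shows "twice_differentiable_on (\<lambda>z. (f z, g z)) U"
proof -
  \<comment> \<open>A pair is the sum of its components embedded linearly, which reduces the claim
    to composition and addition.\<close>
  have "twice_differentiable_on (\<lambda>z. (f z, 0) + (0, g z)) U"
    by (intro twice_differentiable_on_add
        twice_differentiable_on_compose[OF f twice_differentiable_on_bounded_linear[of "\<lambda>x. (x, 0)" UNIV]]
        twice_differentiable_on_compose[OF g twice_differentiable_on_bounded_linear[of "\<lambda>x. (0, x)" UNIV]]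
        bounded_linear_Pair bounded_linear_ident bounded_linear_zero) auto
  then show ?thesis by simp
qed

lemma twice_differentiable_on_mult:
  fixes f g :: "'a::real_normed_vector \<Rightarrow> real"
  assumes f: "twice_differentiable_on f U" and g: "twice_differentiable_on g U"
  shows "twice_differentiable_on (\<lambda>z. f z * g z) U"
proof -
  obtain Df where Df: "\<And>z. z \<in> U \<Longrightarrow> (f has_derivative blinfun_apply (Df z)) (at z)"
    "\<And>z. z \<in> U \<Longrightarrow> Df differentiable at z"
    using f unfolding twice_differentiable_on_def by blast
  obtain Dg where Dg: "\<And>z. z \<in> U \<Longrightarrow> (g has_derivative blinfun_apply (Dg z)) (at z)"
    "\<And>z. z \<in> U \<Longrightarrow> Dg differentiable at z"
    using g unfolding twice_differentiable_on_def by blast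
  show ?thesis
  proof (rule twice_differentiable_onI[where D = "\<lambda>z. f z *\<^sub>R Dg z + g z *\<^sub>R Df z"])
    fix z assume z: "z \<in> U"
    show "((\<lambda>z. f z * g z) has_derivative blinfun_apply (f z *\<^sub>R Dg z + g z *\<^sub>R Df z)) (at z)"
      by (rule has_derivative_eq_rhs[OF has_derivative_mult[OF Df(1)[OF z] Dg(1)[OF z]]])
        (simp add: fun_eq_iff plus_blinfun.rep_eq scaleR_blinfun.rep_eq)
    have "f differentiable at z" "g differentiable at z"
      using z Df(1) Dg(1) by (auto simp: differentiable_def)
    then show "(\<lambda>z. f z *\<^sub>R Dg z + g z *\<^sub>R Df z) differentiable at z"
      using z Df(2) Dg(2) by (intro differentiable_add differentiable_scaleR) auto
  qed
qed

lemma twice_differentiable_on_real: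
  fixes f :: "real \<Rightarrow> real"
  assumes "\<And>t. t \<in> U \<Longrightarrow> (f has_real_derivative f' t) (at t)"
    and "\<And>t. t \<in> U \<Longrightarrow> (f' has_real_derivative f'' t) (at t)"
  shows "twice_differentiable_on f U"
proof (rule twice_differentiable_onI[where D = "\<lambda>t. f' t *\<^sub>R id_blinfun"])
  fix t assume t: "t \<in> U"
  show "(f has_derivative blinfun_apply (f' t *\<^sub>R id_blinfun)) (at t)"
    using assms(1)[OF t] by (simp add: has_field_derivative_def scaleR_blinfun.rep_eq)
  show "(\<lambda>t. f' t *\<^sub>R (id_blinfun :: real \<Rightarrow>\<^sub>L real)) differentiable at t"
    using assms(2)[OF t] by (intro differentiable_scaleR differentiable_const)
      (auto simp: has_field_derivative_def differentiable_def)
qed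

lemma twice_differentiable_on_inner_self:
  fixes U :: "'a::real_inner set"
  shows "twice_differentiable_on (\<lambda>z. z \<bullet> z) U"
proof (rule twice_differentiable_onI[where D = "\<lambda>z. 2 *\<^sub>R blinfun_inner_left z"])
  fix z :: 'a
  show "((\<lambda>z. z \<bullet> z) has_derivative blinfun_apply (2 *\<^sub>R blinfun_inner_left z)) (at z)"
    by (rule has_derivative_eq_rhs[OF has_derivative_inner[OF has_derivative_ident has_derivative_ident]])
      (simp add: fun_eq_iff scaleR_blinfun.rep_eq inner_commute)
  have "bounded_linear (\<lambda>z::'a. 2 *\<^sub>R blinfun_inner_left z)"
    by (intro bounded_linear_const_scaleR bounded_linear_blinfun_inner_left)
  then show "(\<lambda>z::'a. 2 *\<^sub>R blinfun_inner_left z) differentiable at z"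
    using bounded_linear_imp_differentiable by blast
qed

lemma twice_differentiable_on_inverse:
  "twice_differentiable_on inverse {t::real. t \<noteq> 0}"
  by (rule twice_differentiable_on_real[where f' = "\<lambda>t. - (1 / t\<^sup>2)" and f'' = "\<lambda>t. 2 / t ^ 3"])
    (auto intro!: derivative_eq_intros simp: field_simps eval_nat_numeral)

lemma twice_differentiable_on_arccos_sqrt:
  "twice_differentiable_on (\<lambda>t. arccos (sqrt t)) {0<..<1}"
proof (rule twice_differentiable_on_real)
  fix t :: real assume "t \<in> {0<..<1}"
  then have t: "0 < t" "t < 1" "- 1 < sqrt t"
    by (auto intro: less_le_trans[of _ 0])
  show "((\<lambda>t. arccos (sqrt t)) has_real_derivative - inverse (2 * (sqrt t * sqrt (1 - t)))) (at t)"
    using t by (auto intro!: derivative_eq_intros simp: field_simps)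
  show "((\<lambda>t. - inverse (2 * (sqrt t * sqrt (1 - t)))) has_real_derivative
     (inverse (sqrt t) / 2 * sqrt (1 - t) - sqrt t * inverse (sqrt (1 - t)) / 2) / 2 / (sqrt t * sqrt (1 - t))\<^sup>2) (at t)"
    using t by (auto intro!: derivative_eq_intros simp: power2_eq_square divide_simps)
qed

section \<open>The sub-Laplacian on functions of the last coordinate\<close>

lemma norm_quat_square: "(norm (q::quat))\<^sup>2 = (norm (fst q))\<^sup>2 + (norm (snd q))\<^sup>2"
  by (simp add: norm_prod_def)

lemma norm_qmult: "norm (qmult p q) = norm p * norm q"
proof -
  have "(norm (qmult p q))\<^sup>2 = (norm p * norm q)\<^sup>2"
    by (simp add: norm_quat_square power_mult_distrib qmult_def cmod_power2)
      (simp add: power2_eq_square algebra_simps)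
  then show ?thesis
    by (simp add: power2_eq_iff_nonneg)
qed

lemma qmult_assoc: "qmult (qmult p q) s = qmult p (qmult q s)"
  by (simp add: qmult_def algebra_simps)

lemma qmult_add_left: "qmult (p + q) s = qmult p s + qmult q s"
  by (simp add: qmult_def algebra_simps)

lemma qmult_scaleR_left: "qmult (c *\<^sub>R p) s = c *\<^sub>R qmult p s"
  by (simp add: qmult_def algebra_simps)

lemma qmult_add_right: "qmult s (p + q) = qmult s p + qmult s q"
  by (simp add: qmult_def algebra_simps)

lemma qmult_scaleR_right: "qmult s (c *\<^sub>R p) = c *\<^sub>R qmult s p"
  by (simp add: qmult_def algebra_simps)

lemma qmult_qone [simp]: "qmult qone q = q" "qmult q qone = q"
  by (simp_all add: qmult_def qone_def)

lemma qmult_zero_right [simp]: "qmult p 0 = 0"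
  by (simp add: qmult_def zero_prod_def)

lemma qexp_zero [simp]: "qexp S 0 = qone"
  by (simp add: qexp_def)

lemma qmult_qexp: "qmult (qexp S \<theta>) q = cos \<theta> *\<^sub>R q + sin \<theta> *\<^sub>R qmult S q"
  by (simp add: qexp_def qmult_add_left qmult_scaleR_left)

text \<open>The addition theorems make \<open>qexp S\<close> a one-parameter group; this is what
  turns an iterated generator into an ordinary second derivative.\<close>

lemma qmult_qexp_qexp:
  assumes "qmult S S = - qone"
  shows "qmult (qexp S s) (qexp S t) = qexp S (s + t)"
proof -
  have *: "qmult S (qexp S t) = cos t *\<^sub>R S - sin t *\<^sub>R qone"
    by (simp add: assms qexp_def qmult_add_right qmult_scaleR_right)
  show ?thesis
    unfolding qmult_qexp * by (simp add: qexp_def cos_add sin_add algebra_simps)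
qed

lemma norm_qexp:
  assumes "S \<in> {qI, qJ, qK}"
  shows "norm (qexp S \<theta>) = 1"
proof -
  have "(norm (qexp S \<theta>))\<^sup>2 = 1"
    using assms by (auto simp: norm_quat_square qexp_def qone_def qI_def qJ_def qK_def cmod_power2)
  then show ?thesis
    using norm_ge_zero[of "qexp S \<theta>"] by (smt (verit) power2_eq_1_iff)
qed

lemma fst_snd_qact [simp]: "fst (qact g p) $ k = qmult g (fst p $ k)" "snd (qact g p) = qmult g (snd p)"
  by (simp_all add: qact_def)

lemma qact_qone [simp]: "qact qone p = p"
  by (simp add: qact_def prod_eq_iff vec_eq_iff)

lemma qact_qact: "qact g (qact h p) = qact (qmult g h) p"
  by (simp add: qact_def qmult_assoc)

lemma norm_qact: "norm g = 1 \<Longrightarrow> norm (qact g p) = norm p"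
  by (cases p) (simp add: qact_def norm_Pair norm_qmult norm_vec_def)

lemma deriv_shift: "deriv (\<lambda>t. f (t + a)) 0 = deriv f (a::real)"
  unfolding deriv_def using DERIV_shift[of f _ 0 a] by (simp add: add.commute)

text \<open>By the group law, \<open>T_op S u\<close> at the point moved by \<theta> is the
  derivative at \<theta> of \<open>u\<close> along the orbit of \<open>p\<close>.\<close>

lemma T_op_T_op:
  assumes "qmult S S = - qone"
  shows "T_op S (T_op S u) p = deriv (deriv (\<lambda>\<theta>. u (qact (qexp S \<theta>) p))) 0"
  unfolding T_op_def qact_qact qmult_qexp_qexp[OF assms]
  by (simp add: deriv_shift[of "\<lambda>t. u (qact (qexp S t) p)"])

text \<open>The last coordinate moves along cos \<theta> q + sin \<theta> Sq, with velocity Sq and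
  acceleration -q at 0. The action preserves the norm, so the orbit stays where \<open>u\<close> is
  given by \<open>g\<close>.\<close>

lemma T_op_T_op_last_coordinate:
  fixes u :: "'n::finite hspace \<Rightarrow> real" and g :: "quat \<Rightarrow> real"
  assumes U: "open U" "snd p \<in> U" and p: "norm p = 1"
    and D: "\<And>z. z \<in> U \<Longrightarrow> (g has_derivative blinfun_apply (D z)) (at z)"
    and D2: "(D has_derivative D2) (at (snd p))"
    and u: "\<And>z. norm z = 1 \<Longrightarrow> snd z \<in> U \<Longrightarrow> u z = g (snd z)"
    and S: "S \<in> {qI, qJ, qK}"
  shows "T_op S (T_op S u) p = D2 (qmult S (snd p)) (qmult S (snd p)) - D (snd p) (snd p)"
proof -
  define c where "c \<theta> = qmult (qexp S \<theta>) (snd p)" for \<theta>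
  define c1 where "c1 \<theta> = - sin \<theta> *\<^sub>R snd p + cos \<theta> *\<^sub>R qmult S (snd p)" for \<theta>
  have c1: "(c has_vector_derivative c1 t) (at t)" for t
    unfolding c_def c1_def qmult_qexp by (auto intro!: derivative_eq_intros)
  have c2: "(c1 has_vector_derivative - snd p) (at 0)"
    unfolding c1_def by (auto intro!: derivative_eq_intros)
  have c0: "c 0 = snd p" "c1 0 = qmult S (snd p)"
    by (simp_all add: c_def c1_def)
  have "isCont c 0"
    using c1 has_vector_derivative_continuous by blast
  then have "\<forall>\<^sub>F t in nhds 0. c t \<in> U"
    using U c0 by (intro eventually_nhds_isCont) auto
  then have ev: "\<forall>\<^sub>F t in nhds 0. u (qact (qexp S t) p) = g (c t)"
    by eventually_elim (simp add: u norm_qact norm_qexp[OF S] p c_def)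
  have SS: "qmult S S = - qone"
    using S by (auto simp: quaternion_relations)
  have "deriv (deriv (\<lambda>\<theta>. u (qact (qexp S \<theta>) p))) 0 = D2 (c1 0) (c1 0) + D (c 0) (- snd p)"
    using U D D2 c0 by (intro deriv_along_curve(2)[OF U(1) _ D _ c1 c2 ev]) auto
  then show ?thesis
    by (simp add: T_op_T_op[OF SS] c0 blinfun.minus_right)
qed

section \<open>Traces over quaternionic frames and the resulting sub-Laplacian\<close>

lemma sum_Basis_Times:
  fixes f :: "'a::euclidean_space \<times> 'b::euclidean_space \<Rightarrow> real"
  shows "(\<Sum>b\<in>Basis. f b) = (\<Sum>b\<in>Basis. f (b, 0)) + (\<Sum>b\<in>Basis. f (0, b))"
proof -
  have "inj_on (\<lambda>u. (u::'a, 0::'b)) Basis" "inj_on (\<lambda>u. (0::'a, u::'b)) Basis"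
    by (auto intro!: inj_onI)
  then show ?thesis
    unfolding Basis_prod_def
    by (subst sum.union_disjoint) (auto simp: Basis_prod_def sum.reindex)
qed

lemma sum_Basis_quat:
  "(\<Sum>b\<in>Basis. f b) = f (1, 0) + f (\<i>, 0) + f (0, 1) + f (0, \<i> :: complex)" for f :: "quat \<Rightarrow> real"
  by (simp add: sum_Basis_Times Basis_complex_def)

text \<open>If M is the matrix of real coordinates of q, Iq, Jq, Kq, then the transpose of M times M
  is |q|^2 times the identity. Expanding both arguments of \<open>B\<close> therefore leaves only
  diagonal terms.\<close>

lemma quaternion_frame_trace:
  fixes B :: "quat \<Rightarrow> quat \<Rightarrow>\<^sub>L real"
  assumes "linear B"
  shows "B q q + B (qmult qI q) (qmult qI q) + B (qmult qJ q) (qmult qJ q) + B (qmult qK q) (qmult qK q)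
    = (norm q)\<^sup>2 * (\<Sum>b\<in>Basis. B b b)"
proof -
  have rep: "(a, b) = Re a *\<^sub>R (1, 0) + Im a *\<^sub>R (\<i>, 0) + Re b *\<^sub>R (0, 1) + Im b *\<^sub>R (0, \<i>)" for a b
    by (simp add: complex_eq_iff)
  obtain a b where q: "q = (a, b)" by (cases q)
  have I: "qmult qI q = (- Im a) *\<^sub>R (1, 0) + Re a *\<^sub>R (\<i>, 0) + (- Im b) *\<^sub>R (0, 1) + Re b *\<^sub>R (0, \<i>)"
    by (simp add: q qmult_def qI_def complex_eq_iff)
  have J: "qmult qJ q = (- Re b) *\<^sub>R (1, 0) + Im b *\<^sub>R (\<i>, 0) + Re a *\<^sub>R (0, 1) + (- Im a) *\<^sub>R (0, \<i>)"
    by (simp add: q qmult_def qJ_def complex_eq_iff)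
  have K: "qmult qK q = (- Im b) *\<^sub>R (1, 0) + (- Re b) *\<^sub>R (\<i>, 0) + Im a *\<^sub>R (0, 1) + Re a *\<^sub>R (0, \<i>)"
    by (simp add: q qmult_def qK_def complex_eq_iff)
  define e1 e2 e3 e4 :: quat where "e1 = (1, 0)" and "e2 = (\<i>, 0)" and "e3 = (0, 1)" and "e4 = (0, \<i>)"
  have n: "(norm q)\<^sup>2 = (Re a)\<^sup>2 + (Im a)\<^sup>2 + (Re b)\<^sup>2 + (Im b)\<^sup>2"
    by (simp add: q norm_quat_square cmod_power2)
  show ?thesis
    unfolding I J K n sum_Basis_quat
    unfolding q rep[of a b]
    unfolding e1_def[symmetric] e2_def[symmetric] e3_def[symmetric] e4_def[symmetric]
    by (simp only: linear_add[OF assms] linear_cmul[OF assms] blinfun.add_left blinfun.add_right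
        blinfun.scaleR_left blinfun.scaleR_right real_scaleR_def)
      (simp add: algebra_simps power2_eq_square)
qed

lemma sphere_sublaplacian_last_coordinate:
  fixes u :: "'n::finite hspace \<Rightarrow> real" and g :: "quat \<Rightarrow> real"
  assumes U: "open U" "snd p \<in> U" and p: "norm p = 1"
    and D: "\<And>z. z \<in> U \<Longrightarrow> (g has_derivative blinfun_apply (D z)) (at z)"
    and D2: "(D has_derivative D2) (at (snd p))"
    and u: "\<And>z. norm z = 1 \<Longrightarrow> snd z \<in> U \<Longrightarrow> u z = g (snd z)"
  shows "sphere_sublaplacian u p =
    (1 - (norm (snd p))\<^sup>2) * (\<Sum>b\<in>Basis. D2 b b) - 4 * real CARD('n) * D (snd p) (snd p)"
proof -
  let ?q = "snd p"
  have V: "open (snd -` U)" "p \<in> snd -` U"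
    using U by (auto intro: open_vimage_snd)
  have lin: "linear D2"
    using D2 has_derivative_linear by blast
  have d: "((\<lambda>z. g (snd z)) has_derivative blinfun_apply (D (snd z) o\<^sub>L snd_blinfun)) (at z)"
    if "z \<in> snd -` U" for z :: "'n hspace"
    by (rule has_derivative_eq_rhs[OF has_derivative_compose[OF bounded_linear_imp_has_derivative[OF bounded_linear_snd] D]])
      (use that in \<open>auto simp: fun_eq_iff\<close>)
  have "((\<lambda>z::'n hspace. D (snd z)) has_derivative (\<lambda>v. D2 (snd v))) (at p)"
    using has_derivative_compose[OF bounded_linear_imp_has_derivative[OF bounded_linear_snd] D2]
    by (simp add: o_def)
  then have d2: "((\<lambda>z::'n hspace. D (snd z) o\<^sub>L snd_blinfun) has_derivative (\<lambda>v. D2 (snd v) o\<^sub>L snd_blinfun)) (at p)"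
    by (rule bounded_linear.has_derivative[OF bounded_bilinear.bounded_linear_left[OF bounded_bilinear_blinfun_compose]])
  \<comment> \<open>Basis vectors of the first factor have last coordinate 0 and contribute
    nothing.\<close>
  have sum: "(\<Sum>b\<in>(Basis :: 'n hspace set). D2 (snd b) (snd b)) = (\<Sum>b\<in>Basis. D2 b b)"
    by (simp add: sum_Basis_Times linear_0[OF lin])
  have "sphere_laplacian u p = (\<Sum>b\<in>Basis. D2 b b) - D2 ?q ?q - (real DIM('n hspace) - 1) * D ?q ?q"
    using sphere_laplacian_extension[OF V p d d2, of u] u by (simp add: sum)
  \<comment> \<open>The ambient dimension is 4n+4. Of the resulting 4n+3 copies of
    \<open>D ?q ?q\<close>, three are cancelled by the accelerations in the three squared
    generators.\<close>
  then have "sphere_laplacian u p = (\<Sum>b\<in>Basis. D2 b b) - D2 ?q ?q - (4 * real CARD('n) + 3) * D ?q ?q"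
    by (simp add: algebra_simps)
  moreover note T_op_T_op_last_coordinate[OF U p D D2 u, of qI]
    T_op_T_op_last_coordinate[OF U p D D2 u, of qJ] T_op_T_op_last_coordinate[OF U p D D2 u, of qK]
    quaternion_frame_trace[OF lin, of ?q]
  ultimately show ?thesis
    unfolding sphere_sublaplacian_def by (simp add: algebra_simps)
qed

section \<open>The cylindric coordinates of an orbit\<close>

text \<open>Since arccos is decreasing, the infimum is attained at the largest inner product. The
  bound on the absolute value keeps every inner product in [-1, 1], where this monotonicity
  holds.\<close>

lemma orbit_dist_eqI:
  assumes "\<And>p q. p \<in> X \<Longrightarrow> q \<in> Y \<Longrightarrow> \<bar>p \<bullet> q\<bar> \<le> m" and "m \<le> 1"
    and "p \<in> X" "q \<in> Y" "p \<bullet> q = m"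
  shows "orbit_dist X Y = arccos m"
  unfolding orbit_dist_def
proof (rule cInf_eq_minimum)
  show "arccos m \<in> {arccos (p \<bullet> q) |p q. p \<in> X \<and> q \<in> Y}"
    using assms(3-5) by blast
  fix y assume "y \<in> {arccos (p \<bullet> q) |p q. p \<in> X \<and> q \<in> Y}"
  then obtain p q where "p \<in> X" "q \<in> Y" and y: "y = arccos (p \<bullet> q)"
    by blast
  then have "\<bar>p \<bullet> q\<bar> \<le> m" using assms(1) by blast
  then show "arccos m \<le> y"
    unfolding y using assms(2) by (intro arccos_le_arccos) auto
qed

lemma cp_class_self: "p \<in> cp_class p"
  unfolding cp_class_def by (rule range_eqI[of _ _ 0]) simp

lemma norm_qexp_qI [simp]: "norm (qexp qI \<theta>) = 1"
  by (simp add: norm_qexp)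

lemma qexp_qI: "qexp qI \<theta> = (cis \<theta>, 0)"
  by (simp add: qexp_def qone_def qI_def complex_eq_iff)

lemma cp_class_invariants:
  assumes "q \<in> cp_class p"
  shows "norm q = norm p" "norm (snd q) = norm (snd p)"
    "norm (fst (snd q)) = norm (fst (snd p))"
proof -
  obtain \<theta> where "q = qact (qexp qI \<theta>) p"
    using assms by (auto simp: cp_class_def)
  then show "norm q = norm p" "norm (snd q) = norm (snd p)" "norm (fst (snd q)) = norm (fst (snd p))"
    by (simp_all add: norm_qact norm_qmult) (simp add: qmult_def qexp_qI norm_mult)
qed

text \<open>Points over the pole have the form (0, g), so the inner product sees only the last
  coordinate; Cauchy-Schwarz bounds it by the norm of that coordinate.\<close>

lemma cp_r_cp_class:
  assumes p: "norm p = 1"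
  shows "cp_r (cp_class p) = arccos (norm (snd p))"
  unfolding cp_r_def
proof (rule orbit_dist_eqI)
  have hp_north: "hp_class (north_pole :: 'a hspace) = (\<lambda>g. (0, g)) ` sphere 0 1"
    by (simp add: hp_class_def north_pole_def qact_def zero_vec_def)
  fix s t assume s: "s \<in> hp_class (north_pole :: 'a hspace)" and t: "t \<in> cp_to_hp (cp_class p)"
  obtain g where g: "norm g = 1" "s = (0, g)"
    using s hp_north by auto
  obtain q h where q: "q \<in> cp_class p" "norm h = 1" "t = qact h q"
    using t by (auto simp: cp_to_hp_def hp_class_def)
  have "s \<bullet> t = g \<bullet> qmult h (snd q)"
    by (simp add: g q inner_prod_def)
  then show "\<bar>s \<bullet> t\<bar> \<le> norm (snd p)"
    using Cauchy_Schwarz_ineq2[of g "qmult h (snd q)"] g q cp_class_invariants(2)[OF q(1)]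
    by (simp add: norm_qmult)
next
  show "norm (snd p) \<le> 1"
    using p norm_snd_le[of "snd p" "fst p"] by simp
  \<comment> \<open>The unit quaternion aligned with the last coordinate gives equality. If that
    coordinate is 0, any unit quaternion gives the inner product 0.\<close>
  define g where "g = (if snd p = 0 then qone else snd p /\<^sub>R norm (snd p))"
  have g: "norm g = 1"
    by (simp add: g_def qone_def norm_Pair)
  show "(0, g) \<in> hp_class (north_pole :: 'a hspace)"
    using g by (auto simp: hp_class_def north_pole_def qact_def zero_vec_def)
  have "qone \<in> sphere 0 1"
    by (simp add: qone_def norm_Pair)
  then show "p \<in> cp_to_hp (cp_class p)"
    unfolding cp_to_hp_def hp_class_def
    by (intro UN_I[of p] image_eqI[of _ _ qone] cp_class_self) simp_all
  have "(0, g) \<bullet> p = g \<bullet> snd p"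
    by (simp add: inner_prod_def)
  then show "(0, g) \<bullet> p = norm (snd p)"
    by (simp add: g_def dot_square_norm power2_eq_square)
qed

text \<open>The circle lies in the plane of the first complex component, so Cauchy-Schwarz is
  applied to that component alone. At a zero last coordinate both sides are arccos 0, because
  division by 0 yields 0.\<close>

lemma cp_phi_cp_class:
  "cp_phi (cp_class p) = arccos (norm (fst (snd p)) / norm (snd p))"
  unfolding cp_phi_def
proof (rule orbit_dist_eqI)
  fix s t assume "s \<in> range (qexp qI)" "t \<in> (\<lambda>p. snd p /\<^sub>R norm (snd p)) ` cp_class p"
  then obtain \<theta> q where q: "s = qexp qI \<theta>" "q \<in> cp_class p" "t = snd q /\<^sub>R norm (snd q)"
    by blast
  have "\<bar>s \<bullet> t\<bar> = \<bar>cis \<theta> \<bullet> fst (snd q)\<bar> / norm (snd q)"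
    by (simp add: q qexp_qI inner_prod_def abs_mult divide_inverse mult.commute)
  also have "\<dots> \<le> norm (fst (snd q)) / norm (snd q)"
    using Cauchy_Schwarz_ineq2[of "cis \<theta>" "fst (snd q)"] by (intro divide_right_mono) auto
  finally show "\<bar>s \<bullet> t\<bar> \<le> norm (fst (snd p)) / norm (snd p)"
    using cp_class_invariants[OF q(2)] by simp
next
  show "norm (fst (snd p)) / norm (snd p) \<le> 1"
    using norm_fst_le[of "fst (snd p)" "snd (snd p)"] by (auto simp: divide_le_eq_1)
  \<comment> \<open>Equality holds for the circle element with the same phase as the first
    component.\<close>
  show "qexp qI (Arg (fst (snd p))) \<in> range (qexp qI)" by simp
  show "snd p /\<^sub>R norm (snd p) \<in> (\<lambda>p. snd p /\<^sub>R norm (snd p)) ` cp_class p"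
    using cp_class_self by blast
  have "cis (Arg (fst (snd p))) \<bullet> fst (snd p) = norm (fst (snd p))"
  proof -
    have "fst (snd p) = norm (fst (snd p)) *\<^sub>R cis (Arg (fst (snd p)))"
      by (metis rcis_cmod_Arg rcis_def scaleR_conv_of_real)
    then have "cis (Arg (fst (snd p))) \<bullet> fst (snd p) =
        norm (fst (snd p)) * (cis (Arg (fst (snd p))) \<bullet> cis (Arg (fst (snd p))))"
      by (metis inner_scaleR_right)
    then show ?thesis by (simp add: norm_eq_1[symmetric])
  qed
  then show "qexp qI (Arg (fst (snd p))) \<bullet> (snd p /\<^sub>R norm (snd p)) = norm (fst (snd p)) / norm (snd p)"
    by (simp add: qexp_qI inner_prod_def divide_inverse mult.commute)
qed

section \<open>The radial part\<close>

text \<open>The trace on a plane does not change when its frame is rotated: the mixed terms cancel.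
  It serves to compare the frame adapted to \<open>q\<close> with the standard basis.\<close>

lemma rotated_pair_trace:
  fixes B :: "'a::real_normed_vector \<Rightarrow> 'a \<Rightarrow>\<^sub>L real"
  assumes "linear B" and cs: "c\<^sup>2 + s\<^sup>2 = 1"
  shows "B (c *\<^sub>R v + s *\<^sub>R w) (c *\<^sub>R v + s *\<^sub>R w) + B (c *\<^sub>R w - s *\<^sub>R v) (c *\<^sub>R w - s *\<^sub>R v)
    = B v v + B w w"
proof -
  have "B (c *\<^sub>R v + s *\<^sub>R w) (c *\<^sub>R v + s *\<^sub>R w) + B (c *\<^sub>R w - s *\<^sub>R v) (c *\<^sub>R w - s *\<^sub>R v)
    = (c\<^sup>2 + s\<^sup>2) * (B v v + B w w)"
    by (simp add: linear_add[OF assms(1)] linear_diff[OF assms(1)] linear_cmul[OF assms(1)]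
        blinfun.bilinear_simps algebra_simps power2_eq_square)
  then show ?thesis using cs by simp
qed

definition cyl_fun :: "(real \<times> real \<Rightarrow> real) \<Rightarrow> quat \<Rightarrow> real" where
  "cyl_fun F q = F (arccos (norm q), arccos (norm (fst q) / norm q))"

text \<open>The interior of the coordinate range: norm below 1 means r > 0, a nonzero first
  component means r < pi/2 and phi < pi/2, and a nonzero second component then means phi >
  0.\<close>

definition cyl_dom :: "quat set" where
  "cyl_dom = {q. norm q < 1 \<and> fst q \<noteq> 0 \<and> snd q \<noteq> 0}"

lemma open_cyl_dom: "open cyl_dom"
  unfolding cyl_dom_def
  by (intro open_Collect_conj open_Collect_less open_Collect_neq continuous_intros)

text \<open>For unit \<open>a\<close> and \<open>b\<close>, varying \<open>s\<close> or
  \<open>t\<close> alone moves r or phi alone, while changing the phases \<open>a\<close> and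
  \<open>b\<close> leaves both coordinates fixed.\<close>

definition cyl_point :: "complex \<Rightarrow> complex \<Rightarrow> real \<Rightarrow> real \<Rightarrow> quat" where
  "cyl_point a b s t = cos s *\<^sub>R (cos t *\<^sub>R a, sin t *\<^sub>R b)"

lemma
  assumes ab: "norm a = 1" "norm b = 1" and st: "0 < s" "s < pi / 2" "0 < t" "t < pi / 2"
  shows norm_cyl_point: "norm (cyl_point a b s t) = cos s"
    and norm_fst_cyl_point: "norm (fst (cyl_point a b s t)) = cos s * cos t"
    and cyl_point_in_cyl_dom: "cyl_point a b s t \<in> cyl_dom"
    and cyl_fun_cyl_point: "cyl_fun F (cyl_point a b s t) = F (s, t)"
proof -
  have pos: "0 < cos s" "0 < cos t" "0 < sin t" "cos s < 1"
    using st cos_gt_zero[of s] cos_gt_zero[of t] sin_gt_zero[of t] cos_monotone_0_pi[of 0 s] by auto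
  have "(cos s * cos t)\<^sup>2 + (cos s * sin t)\<^sup>2 = (cos s)\<^sup>2"
    by (simp add: power_mult_distrib flip: distrib_left)
  then show n: "norm (cyl_point a b s t) = cos s"
    using ab pos by (simp add: cyl_point_def norm_Pair)
  show m: "norm (fst (cyl_point a b s t)) = cos s * cos t"
    using ab pos by (simp add: cyl_point_def)
  have "a \<noteq> 0" "b \<noteq> 0" using ab by auto
  then show "cyl_point a b s t \<in> cyl_dom"
    using pos n by (simp add: cyl_dom_def) (simp add: cyl_point_def)
  show "cyl_fun F (cyl_point a b s t) = F (s, t)"
    unfolding cyl_fun_def n m using st pos by (simp add: arccos_cos)
qed

section \<open>Interior points and their polar form\<close>

lemma arccos_between_0_pi_half:
  assumes "0 \<le> x" "x \<le> 1"
  shows "0 < arccos x \<longleftrightarrow> x < 1" "arccos x < pi / 2 \<longleftrightarrow> 0 < x"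
proof -
  have "arccos x < arccos 0 \<longleftrightarrow> 0 < x" "arccos 1 < arccos x \<longleftrightarrow> x < 1"
    using assms arccos_less_mono[of x 0] arccos_less_mono[of 1 x] by auto
  then show "0 < arccos x \<longleftrightarrow> x < 1" "arccos x < pi / 2 \<longleftrightarrow> 0 < x"
    by simp_all
qed

lemma cyl_dom_iff:
  assumes q: "norm q \<le> 1"
  shows "q \<in> cyl_dom \<longleftrightarrow> 0 < arccos (norm q) \<and> arccos (norm q) < pi / 2 \<and>
    0 < arccos (norm (fst q) / norm q) \<and> arccos (norm (fst q) / norm q) < pi / 2"
proof (cases "q = 0")
  case True
  then show ?thesis by (simp add: cyl_dom_def)
next
  case False
  have "norm (fst q) / norm q < 1 \<longleftrightarrow> snd q \<noteq> 0"
  proof -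
    have "norm (fst q) < norm q \<longleftrightarrow> (norm (fst q))\<^sup>2 < (norm q)\<^sup>2"
      by (metis norm_ge_zero power2_less_imp_less power_strict_mono zero_less_numeral)
    then show ?thesis
      using False by (simp add: norm_quat_square divide_less_eq_1)
  qed
  moreover have "norm (fst q) / norm q \<le> 1"
    using norm_fst_le[of "fst q" "snd q"] by (simp add: divide_le_eq_1)
  moreover have "0 < norm (fst q) / norm q \<longleftrightarrow> fst q \<noteq> 0"
    using False by (simp add: zero_less_divide_iff)
  ultimately show ?thesis
    using False q arccos_between_0_pi_half[of "norm q"] arccos_between_0_pi_half[of "norm (fst q) / norm q"]
    by (auto simp: cyl_dom_def)
qed

text \<open>Polar form of the two complex components: \<open>a\<close> and \<open>b\<close> are
  their phases, and their moduli are |q| cos phi and |q| sin phi.\<close>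

lemma cyl_dom_decompose:
  assumes q: "q \<in> cyl_dom"
  obtains a b where "norm a = 1" "norm b = 1"
    "q = cyl_point a b (arccos (norm q)) (arccos (norm (fst q) / norm q))"
proof
  let ?t = "arccos (norm (fst q) / norm q)"
  have q': "q \<noteq> 0" "fst q \<noteq> 0" "snd q \<noteq> 0" "norm q < 1"
    using q by (auto simp: cyl_dom_def)
  show "norm (sgn (fst q)) = 1" "norm (sgn (snd q)) = 1"
    using q' by (simp_all add: norm_sgn)
  have le: "norm (fst q) / norm q \<le> 1"
    using norm_fst_le[of "fst q" "snd q"] by (simp add: divide_le_eq_1)
  have ct: "norm q * cos ?t = norm (fst q)"
    using le q' by (subst cos_arccos) (auto intro: order_trans[of _ 0])
  have "0 \<le> sin ?t"
    using le by (intro sin_ge_zero arccos_lbound arccos_ubound) (auto intro: order_trans[of _ 0])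
  moreover have "(norm q * sin ?t)\<^sup>2 = (norm (snd q))\<^sup>2"
  proof -
    have "(norm q * sin ?t)\<^sup>2 = (norm q)\<^sup>2 - (norm q * cos ?t)\<^sup>2"
      by (simp add: power_mult_distrib sin_squared_eq algebra_simps)
    then show ?thesis
      unfolding ct by (simp add: norm_quat_square)
  qed
  ultimately have st: "norm q * sin ?t = norm (snd q)"
    by (simp add: power2_eq_iff_nonneg)
  have "cos (arccos (norm q)) = norm q"
    using q' by (intro cos_arccos) (auto intro: order_trans[of _ 0])
  then show "q = cyl_point (sgn (fst q)) (sgn (snd q)) (arccos (norm q)) ?t"
    using q' ct st by (simp add: cyl_point_def prod_eq_iff sgn_div_norm flip: mult.assoc)
qed

text \<open>Writing norms as square roots of inner products turns both coordinates into arccos (sqrt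
  t), with t either z \<bullet> z or a quotient of two such products. On \<open>cyl_dom\<close> both
  values of t lie strictly between 0 and 1.\<close>

lemma twice_differentiable_on_cyl_fun:
  assumes F: "twice_differentiable_on F ({0<..<pi/2} \<times> {0<..<pi/2})"
  shows "twice_differentiable_on (cyl_fun F) cyl_dom"
proof -
  let ?k = "\<lambda>t. arccos (sqrt t)"
  have pos: "z \<noteq> 0" "z \<bullet> z < 1" "fst z \<bullet> fst z * inverse (z \<bullet> z) \<in> {0<..<1}" if "z \<in> cyl_dom" for z
  proof -
    have z: "norm z < 1" "fst z \<noteq> 0" "snd z \<noteq> 0" using that by (auto simp: cyl_dom_def)
    then show "z \<noteq> 0" by auto
    show "z \<bullet> z < 1"
      using z(1) by (simp add: dot_square_norm power_less_one_iff)
    have "z \<bullet> z = fst z \<bullet> fst z + snd z \<bullet> snd z" by (simp add: inner_prod_def)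
    moreover have "fst z \<bullet> fst z > 0" "snd z \<bullet> snd z > 0" using z by auto
    ultimately show "fst z \<bullet> fst z * inverse (z \<bullet> z) \<in> {0<..<1}"
      by (simp add: field_simps add_pos_pos)
  qed
  have 1: "twice_differentiable_on (\<lambda>z. ?k (z \<bullet> z)) cyl_dom"
    by (rule twice_differentiable_on_compose[OF twice_differentiable_on_inner_self twice_differentiable_on_arccos_sqrt])
      (use pos in auto)
  have "twice_differentiable_on (\<lambda>z. fst z \<bullet> fst z * inverse (z \<bullet> z)) cyl_dom"
    by (intro twice_differentiable_on_mult
        twice_differentiable_on_compose[OF twice_differentiable_on_bounded_linear[OF bounded_linear_fst]
          twice_differentiable_on_inner_self[of UNIV]]
        twice_differentiable_on_compose[OF twice_differentiable_on_inner_self twice_differentiable_on_inverse])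
      (use pos in auto)
  then have 2: "twice_differentiable_on (\<lambda>z. ?k (fst z \<bullet> fst z * inverse (z \<bullet> z))) cyl_dom"
    by (rule twice_differentiable_on_compose[OF _ twice_differentiable_on_arccos_sqrt]) (rule pos)
  have eq: "(?k (z \<bullet> z), ?k (fst z \<bullet> fst z * inverse (z \<bullet> z)))
      = (arccos (norm z), arccos (norm (fst z) / norm z))" for z
    by (simp add: norm_eq_sqrt_inner real_sqrt_mult real_sqrt_inverse divide_inverse)
  have 3: "(arccos (norm z), arccos (norm (fst z) / norm z)) \<in> {0<..<pi/2} \<times> {0<..<pi/2}"
    if "z \<in> cyl_dom" for z
  proof -
    have "norm z \<le> 1" using that by (simp add: cyl_dom_def)
    then show ?thesis
      using cyl_dom_iff[of z] that by simp
  qed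
  have "twice_differentiable_on (\<lambda>z. F (arccos (norm z), arccos (norm (fst z) / norm z))) cyl_dom"
    by (rule twice_differentiable_on_compose[OF twice_differentiable_on_Pair[OF 1 2] F, unfolded eq])
      (rule 3)
  then show ?thesis by (simp add: cyl_fun_def[abs_def])
qed

text \<open>The orthonormal frame is \<open>e\<close> (the direction of \<open>q\<close>),
  \<open>w\<close> (the phi-direction), (\<i> a, 0) and (0, \<i> b). One curve per vector expresses
  the corresponding diagonal value of \<open>D2\<close> by derivatives of F.\<close>

lemma cyl_fun_radial_operator:
  fixes F :: "real \<times> real \<Rightarrow> real" and a b :: complex and r \<phi> N :: real
  defines "q \<equiv> cyl_point a b r \<phi>"
  assumes ab: "norm a = 1" "norm b = 1"
    and r: "0 < r" "r < pi / 2" and \<phi>: "0 < \<phi>" "\<phi> < pi / 2"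
    and D: "\<And>z. z \<in> cyl_dom \<Longrightarrow> (cyl_fun F has_derivative blinfun_apply (D z)) (at z)"
    and D2: "(D has_derivative D2) (at q)"
  shows "(1 - (norm q)\<^sup>2) * (\<Sum>b\<in>Basis. D2 b b) - 4 * N * D q q =
      deriv (deriv (\<lambda>s. F (s, \<phi>))) r
    + ((4 * N - 1) * cot r - 3 * tan r) * deriv (\<lambda>s. F (s, \<phi>)) r
    + (tan r)\<^sup>2 * (deriv (deriv (\<lambda>t. F (r, t))) \<phi>
                  + 2 * cot (2 * \<phi>) * deriv (\<lambda>t. F (r, t)) \<phi>)"
proof -
  define S C s c where "S = sin r" and "C = cos r" and "s = sin \<phi>" and "c = cos \<phi>"
  have pos: "0 < S" "0 < C" "0 < s" "0 < c"
    using r \<phi> by (auto simp: S_def C_def s_def c_def intro!: sin_gt_zero cos_gt_zero)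
  have sc: "s\<^sup>2 + c\<^sup>2 = 1" "S\<^sup>2 + C\<^sup>2 = 1"
    by (simp_all add: S_def C_def s_def c_def)
  have lin: "linear D2"
    using D2 has_derivative_linear by blast
  define e w :: quat where "e = (c *\<^sub>R a, s *\<^sub>R b)" and "w = (- s *\<^sub>R a, c *\<^sub>R b)"
  have q: "q = C *\<^sub>R e"
    by (simp add: q_def cyl_point_def C_def c_def s_def e_def)
  have q_dom: "q \<in> cyl_dom"
    unfolding q_def using ab r \<phi> by (rule cyl_point_in_cyl_dom)
  note curve = deriv_along_curve[where ?D2.0 = D2, OF open_cyl_dom _ D]
  have scale: "D2 (x *\<^sub>R v) (x *\<^sub>R v) = x\<^sup>2 * D2 v v" for x v
    by (simp add: linear_cmul[OF lin] blinfun.bilinear_simps power2_eq_square)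

  have ev: "\<forall>\<^sub>F t in nhds \<phi>. t \<in> {0<..<pi/2}" "\<forall>\<^sub>F t in nhds r. t \<in> {0<..<pi/2}"
    by (intro eventually_nhds_in_open open_greaterThanLessThan; use r \<phi> in simp)+

  \<comment> \<open>The curve is the ray through \<open>e\<close>, with velocity -S e and
    acceleration -C e.\<close>
  have r_curve: "deriv (\<lambda>s. F (s, \<phi>)) r = - S * D q e"
    "deriv (deriv (\<lambda>s. F (s, \<phi>))) r = S\<^sup>2 * D2 e e - C * D q e"
  proof -
    have 1: "((\<lambda>t. cos t *\<^sub>R e) has_vector_derivative (- sin t) *\<^sub>R e) (at t)" for t
      by (auto intro!: derivative_eq_intros)
    have 2: "((\<lambda>t. (- sin t) *\<^sub>R e) has_vector_derivative (- C) *\<^sub>R e) (at r)"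
      by (auto intro!: derivative_eq_intros simp: C_def)
    have 3: "\<forall>\<^sub>F t in nhds r. F (t, \<phi>) = cyl_fun F (cos t *\<^sub>R e)"
      by (rule eventually_mono[OF ev(2)])
        (use cyl_fun_cyl_point[OF ab _ _ \<phi>, of _ F] in \<open>simp add: cyl_point_def e_def c_def s_def\<close>)
    have d1: "deriv (\<lambda>s. F (s, \<phi>)) r = D q ((- S) *\<^sub>R e)"
      by (rule curve(1)[OF _ _ _ 1 2 3, folded S_def C_def, folded q]) (use D2 q_dom in simp_all)
    have d2: "deriv (deriv (\<lambda>s. F (s, \<phi>))) r = D2 ((- S) *\<^sub>R e) ((- S) *\<^sub>R e) + D q ((- C) *\<^sub>R e)"
      by (rule curve(2)[OF _ _ _ 1 2 3, folded S_def C_def, folded q]) (use D2 q_dom in simp_all)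
    show "deriv (\<lambda>s. F (s, \<phi>)) r = - S * D q e"
      "deriv (deriv (\<lambda>s. F (s, \<phi>))) r = S\<^sup>2 * D2 e e - C * D q e"
      using d1 d2 unfolding scale unfolding blinfun.scaleR_right by simp_all
  qed

  \<comment> \<open>The curve is a circle of radius C in the plane of (a, 0) and (0, b), with
    velocity C w and acceleration -C e.\<close>
  have \<phi>_curve: "deriv (\<lambda>t. F (r, t)) \<phi> = C * D q w"
    "deriv (deriv (\<lambda>t. F (r, t))) \<phi> = C\<^sup>2 * D2 w w - C * D q e"
  proof -
    let ?c = "\<lambda>t. (cos t *\<^sub>R (C *\<^sub>R a), sin t *\<^sub>R (C *\<^sub>R b))"
    let ?c1 = "\<lambda>t. (- sin t *\<^sub>R (C *\<^sub>R a), cos t *\<^sub>R (C *\<^sub>R b))"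
    have 1: "(?c has_vector_derivative ?c1 t) (at t)" for t
      by (intro has_vector_derivative_Pair) (auto intro!: derivative_eq_intros)
    have 2: "(?c1 has_vector_derivative (- C) *\<^sub>R e) (at \<phi>)"
      unfolding e_def c_def s_def scaleR_Pair
      by (intro has_vector_derivative_Pair) (auto intro!: derivative_eq_intros)
    have 3: "\<forall>\<^sub>F t in nhds \<phi>. F (r, t) = cyl_fun F (?c t)"
      by (rule eventually_mono[OF ev(1)])
        (use cyl_fun_cyl_point[OF ab r, of _ F] in \<open>simp add: cyl_point_def C_def mult.commute\<close>)
    have 4: "?c \<phi> = q" and 5: "?c1 \<phi> = C *\<^sub>R w"
      by (simp_all add: q e_def w_def c_def s_def)
    have d1: "deriv (\<lambda>t. F (r, t)) \<phi> = D q (C *\<^sub>R w)"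
      by (rule curve(1)[OF _ _ _ 1 2 3, unfolded 4 5]) (use D2 q_dom in simp_all)
    have d2: "deriv (deriv (\<lambda>t. F (r, t))) \<phi> = D2 (C *\<^sub>R w) (C *\<^sub>R w) + D q ((- C) *\<^sub>R e)"
      by (rule curve(2)[OF _ _ _ 1 2 3, unfolded 4 5]) (use D2 q_dom in simp_all)
    show "deriv (\<lambda>t. F (r, t)) \<phi> = C * D q w"
      "deriv (deriv (\<lambda>t. F (r, t))) \<phi> = C\<^sup>2 * D2 w w - C * D q e"
      using d1 d2 unfolding scale unfolding blinfun.scaleR_right by simp_all
  qed

  \<comment> \<open>Inverting the rotation lets the accelerations of the phase curves be expressed
    by the r- and phi-directions.\<close>
  have A: "(a, 0) = c *\<^sub>R e - s *\<^sub>R w" and B: "(0, b) = s *\<^sub>R e + c *\<^sub>R w"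
    using sc by (simp_all add: e_def w_def algebra_simps power2_eq_square flip: scaleR_add_left)

  \<comment> \<open>Rotating the phase of \<open>a\<close> describes a circle of radius C c on which
    the function is constant. Its vanishing second derivative equates the \<open>D2\<close> term
    with the acceleration term, and one factor C c is cancelled.\<close>
  have a_curve: "C * c * D2 (\<i> * a, 0) (\<i> * a, 0) = D q (a, 0)"
  proof -
    let ?c = "\<lambda>t. cos t *\<^sub>R (C * c) *\<^sub>R (a, 0) + sin t *\<^sub>R (C * c) *\<^sub>R (\<i> * a, 0) + (0, (C * s) *\<^sub>R b)"
    let ?c1 = "\<lambda>t. (- sin t) *\<^sub>R (C * c) *\<^sub>R (a, 0) + cos t *\<^sub>R (C * c) *\<^sub>R (\<i> * a, 0)"
    have 1: "(?c has_vector_derivative ?c1 t) (at t)" for t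
      by (auto intro!: derivative_eq_intros)
    have 2: "(?c1 has_vector_derivative (- C * c) *\<^sub>R (a, 0)) (at 0)"
      by (auto intro!: derivative_eq_intros)
    have "?c t = cyl_point (cis t * a) b r \<phi>" for t
      by (simp add: cyl_point_def C_def c_def s_def complex_eq_iff algebra_simps)
    then have 3: "\<forall>\<^sub>F t in nhds 0. F (r, \<phi>) = cyl_fun F (?c t)"
      using ab r \<phi> by (simp add: cyl_fun_cyl_point norm_mult)
    have 4: "?c 0 = q"
      by (simp add: q e_def)
    have "0 = D2 ((C * c) *\<^sub>R (\<i> * a, 0)) ((C * c) *\<^sub>R (\<i> * a, 0)) + D q ((- C * c) *\<^sub>R (a, 0))"
      using curve(2)[OF _ _ _ 1 2 3, unfolded 4] D2 q_dom by simp
    then have "C * c * (C * c * D2 (\<i> * a, 0) (\<i> * a, 0)) = C * c * D q (a, 0)"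
      unfolding scale by (simp only: blinfun.bilinear_simps) (simp add: power2_eq_square mult.assoc)
    then show ?thesis using pos by simp
  qed

  \<comment> \<open>The same for the phase of \<open>b\<close>, now on a circle of radius C
    s.\<close>
  have b_curve: "C * s * D2 (0, \<i> * b) (0, \<i> * b) = D q (0, b)"
  proof -
    let ?c = "\<lambda>t. cos t *\<^sub>R (C * s) *\<^sub>R (0, b) + sin t *\<^sub>R (C * s) *\<^sub>R (0, \<i> * b) + ((C * c) *\<^sub>R a, 0)"
    let ?c1 = "\<lambda>t. (- sin t) *\<^sub>R (C * s) *\<^sub>R (0, b) + cos t *\<^sub>R (C * s) *\<^sub>R (0, \<i> * b)"
    have 1: "(?c has_vector_derivative ?c1 t) (at t)" for t
      by (auto intro!: derivative_eq_intros)
    have 2: "(?c1 has_vector_derivative (- C * s) *\<^sub>R (0, b)) (at 0)"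
      by (auto intro!: derivative_eq_intros)
    have "?c t = cyl_point a (cis t * b) r \<phi>" for t
      by (simp add: cyl_point_def C_def c_def s_def complex_eq_iff algebra_simps)
    then have 3: "\<forall>\<^sub>F t in nhds 0. F (r, \<phi>) = cyl_fun F (?c t)"
      using ab r \<phi> by (simp add: cyl_fun_cyl_point norm_mult)
    have 4: "?c 0 = q"
      by (simp add: q e_def)
    have "0 = D2 ((C * s) *\<^sub>R (0, \<i> * b)) ((C * s) *\<^sub>R (0, \<i> * b)) + D q ((- C * s) *\<^sub>R (0, b))"
      using curve(2)[OF _ _ _ 1 2 3, unfolded 4] D2 q_dom by simp
    then have "C * s * (C * s * D2 (0, \<i> * b) (0, \<i> * b)) = C * s * D q (0, b)"
      unfolding scale by (simp only: blinfun.bilinear_simps) (simp add: power2_eq_square mult.assoc)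
    then show ?thesis using pos by simp
  qed

  \<comment> \<open>Three plane rotations lead from the adapted frame to the standard basis: by
    \<phi> in the plane of \<open>e\<close> and \<open>w\<close>, and by the phases of
    \<open>a\<close> and \<open>b\<close> in the two complex lines.\<close>
  have trace: "(\<Sum>b\<in>Basis. D2 b b) = D2 e e + D2 w w + D2 (\<i> * a, 0) (\<i> * a, 0) + D2 (0, \<i> * b) (0, \<i> * b)"
  proof -
    have ew: "e = c *\<^sub>R (a, 0) + s *\<^sub>R (0, b)" "w = c *\<^sub>R (0, b) - s *\<^sub>R (a, 0)"
      by (simp_all add: e_def w_def)
    have a: "(a, 0) = Re a *\<^sub>R (1, 0) + Im a *\<^sub>R (\<i>, 0::complex)"
      "(\<i> * a, 0) = Re a *\<^sub>R (\<i>, 0) - Im a *\<^sub>R (1, 0::complex)"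
      by (simp_all add: complex_eq_iff)
    have b: "(0, b) = Re b *\<^sub>R (0::complex, 1) + Im b *\<^sub>R (0, \<i>)"
      "(0, \<i> * b) = Re b *\<^sub>R (0::complex, \<i>) - Im b *\<^sub>R (0, 1)"
      by (simp_all add: complex_eq_iff)
    have "D2 e e + D2 w w = D2 (a, 0) (a, 0) + D2 (0, b) (0, b)"
      unfolding ew by (rule rotated_pair_trace[OF lin]) (use sc in simp)
    moreover have "D2 (a, 0) (a, 0) + D2 (\<i> * a, 0) (\<i> * a, 0) = D2 (1, 0) (1, 0) + D2 (\<i>, 0) (\<i>, 0)"
      unfolding a by (rule rotated_pair_trace[OF lin]) (use ab cmod_power2[of a] in simp)
    moreover have "D2 (0, b) (0, b) + D2 (0, \<i> * b) (0, \<i> * b) = D2 (0, 1) (0, 1) + D2 (0, \<i>) (0, \<i>)"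
      unfolding b by (rule rotated_pair_trace[OF lin]) (use ab cmod_power2[of b] in simp)
    ultimately show ?thesis
      by (simp add: sum_Basis_quat)
  qed

  have h3: "D2 (\<i> * a, 0) (\<i> * a, 0) = (D q e - s / c * D q w) / C"
    using a_curve pos unfolding A by (simp add: blinfun.bilinear_simps field_simps)
  have h4: "D2 (0, \<i> * b) (0, \<i> * b) = (D q e + c / s * D q w) / C"
    using b_curve pos unfolding B by (simp add: blinfun.bilinear_simps field_simps)
  \<comment> \<open>The right-hand side collects the coefficients of \<open>D q w\<close> in
    \<open>h3\<close> and \<open>h4\<close>, up to the common factor 1/C.\<close>
  have cot2: "2 * cot (2 * \<phi>) = c / s - s / c"
    using pos by (simp add: cot_def cos_double sin_double flip: s_def c_def)
      (simp add: field_simps power2_eq_square)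
  have "norm q = C"
    unfolding q_def C_def using ab r \<phi> by (rule norm_cyl_point)
  then have nq: "1 - (norm q)\<^sup>2 = S\<^sup>2"
    using sc by simp
  have Dqq: "D q q = C * D q e"
    by (subst (2) q) (simp add: blinfun.bilinear_simps)
  have trig: "cot r = C / S" "tan r = S / C"
    by (simp_all add: cot_def tan_def C_def S_def)
  show ?thesis
    unfolding nq trace h3 h4 Dqq r_curve \<phi>_curve cot2 trig
    using pos by (simp add: field_simps power2_eq_square)
qed

theorem mainTheorem12:
  fixes F :: "real \<times> real \<Rightarrow> real"
    and f :: "'n::finite hspace set \<Rightarrow> real"
    and x :: "'n hspace set"
    and r \<phi> :: real
  assumes "C2_on F ({0<..<pi/2} \<times> {0<..<pi/2})"
    and "\<And>y. y \<in> cp_space \<Longrightarrow> 0 < cp_r y \<Longrightarrow> cp_r y < pi/2 \<Longrightarrow>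
           0 < cp_phi y \<Longrightarrow> cp_phi y < pi/2 \<Longrightarrow> f y = F (cp_r y, cp_phi y)"
    and "x \<in> cp_space"
    and "r = cp_r x" and "0 < r" and "r < pi/2"
    and "\<phi> = cp_phi x" and "0 < \<phi>" and "\<phi> < pi/2"
  shows "cp_sublaplacian f x =
           deriv (deriv (\<lambda>s. F (s, \<phi>))) r
         + ((4 * real CARD('n) - 1) * cot r - 3 * tan r) * deriv (\<lambda>s. F (s, \<phi>)) r
         + (tan r)\<^sup>2 * (deriv (deriv (\<lambda>t. F (r, t))) \<phi>
                       + 2 * cot (2 * \<phi>) * deriv (\<lambda>t. F (r, t)) \<phi>)"
    (is "_ = ?rhs")
proof -
  obtain D where D: "\<And>z. z \<in> cyl_dom \<Longrightarrow> (cyl_fun F has_derivative blinfun_apply (D z)) (at z)"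
    and D_diff: "\<And>z. z \<in> cyl_dom \<Longrightarrow> D differentiable at z"
    using twice_differentiable_on_cyl_fun[OF C2_on_imp_twice_differentiable_on[OF assms(1)]]
    unfolding twice_differentiable_on_def by blast
  have le1: "norm (snd z) \<le> 1" if "norm z = 1" for z :: "'n hspace"
    using norm_snd_le[of "snd z" "fst z"] that by simp
  \<comment> \<open>The conditions defining \<open>cyl_dom\<close> are exactly the interior
    conditions under which \<open>f\<close> is known to be given by \<open>F\<close>.\<close>
  have fcyl: "(f \<circ> cp_class) z = cyl_fun F (snd z)" if z: "norm z = 1" "snd z \<in> cyl_dom" for z
    using assms(2)[of "cp_class z"] z cyl_dom_iff[OF le1[OF z(1)]]
    by (simp add: cp_r_cp_class cp_phi_cp_class cp_space_def cyl_fun_def)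
  obtain p0 where p0: "norm p0 = 1" "x = cp_class p0"
    using assms(3) by (auto simp: cp_space_def)
  \<comment> \<open>The projected operator asks for one value common to all representatives. The
    coordinates are the same for all of them, and the right-hand side depends on nothing
    else.\<close>
  have val: "sphere_sublaplacian (f \<circ> cp_class) p = ?rhs" if "p \<in> x" for p
  proof -
    note inv = cp_class_invariants[OF that[unfolded p0(2)]]
    have p: "norm p = 1" using inv(1) p0(1) by simp
    have r: "r = arccos (norm (snd p))" and \<phi>: "\<phi> = arccos (norm (fst (snd p)) / norm (snd p))"
      using assms(4,7) p0 inv by (simp_all add: cp_r_cp_class cp_phi_cp_class)
    have dom: "snd p \<in> cyl_dom"
      using cyl_dom_iff[OF le1[OF p]] assms r \<phi> by simp
    obtain a b where ab: "norm a = 1" "norm b = 1" and q: "snd p = cyl_point a b r \<phi>"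
      using cyl_dom_decompose[OF dom] r \<phi> by metis
    obtain D2 where D2: "(D has_derivative D2) (at (snd p))"
      using D_diff[OF dom] by (auto simp: differentiable_def)
    have "sphere_sublaplacian (f \<circ> cp_class) p =
        (1 - (norm (snd p))\<^sup>2) * (\<Sum>b\<in>Basis. D2 b b) - 4 * real CARD('n) * D (snd p) (snd p)"
      using sphere_sublaplacian_last_coordinate[OF open_cyl_dom dom p D D2 fcyl] .
    also have "\<dots> = ?rhs"
      using cyl_fun_radial_operator[OF ab assms(5,6,8,9) D D2[unfolded q]] unfolding q .
    finally show ?thesis .
  qed
  \<comment> \<open>Since \<open>x\<close> contains \<open>p0\<close>, no other constant can be the
    common value.\<close>
  then show ?thesis
    unfolding cp_sublaplacian_def using cp_class_self[of p0] p0(2)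
    by (intro the_equality) auto
qed

end
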